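(* Let $0<q<1$ and let $x,y,a,t$ be complex numbers with $|xt|<1$. Then $$\sum_{n=0}^\infty p_n(x,y,a)\frac{t^n}{(q;q)_n}=\frac{1}{(xt;q)_\infty}\;{}_1\Phi_1\left(\begin{array}{c}a\\0\end{array}\Big|\,q;yt\right).$$
   Context: For complex $c$: $(c;q)_0=1$, $(c;q)_n=\prod_{i=0}^{n-1}(1-cq^i)$, $(c;q)_\infty=\prod_{i=0}^\infty(1-cq^i)$. The $q$-binomial coefficient is $\left[{n\atop k}\right]_q=\dfrac{(q;q)_n}{(q;q)_k(q;q)_{n-k}}$. The generalized Cauchy polynomials are $$p_n(x,y,a)=\sum_{k=0}^n\left[{n\atop k}\right]_q(-1)^kq^{\binom k2}(a;q)_k\,x^{n-k}y^k.$$ The series ${}_1\Phi_1$ is $${}_1\Phi_1\left(\begin{array}{c}a\\0\end{array}\Big|\,q;z\right)=\sum_{n=0}^\infty(-1)^nq^{\binom n2}\frac{(a;q)_n}{(q;q)_n}z^n.$$ *)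

theory Defs
  imports "HOL-Analysis.Analysis"
begin

definition qpoch :: "complex \<Rightarrow> complex \<Rightarrow> nat \<Rightarrow> complex" where
  "qpoch c q n = (\<Prod>i<n. 1 - c * q ^ i)"

definition qpoch_inf :: "complex \<Rightarrow> complex \<Rightarrow> complex" where
  "qpoch_inf c q = (\<Prod>i. 1 - c * q ^ i)"

(* Meant for k \<le> n only: for k > n the subtraction on nat truncates and the value
   is not the conventional 0. *)
definition qbinom :: "complex \<Rightarrow> nat \<Rightarrow> nat \<Rightarrow> complex" where
  "qbinom q n k = qpoch q q n / (qpoch q q k * qpoch q q (n - k))"

definition gen_cauchy_poly ::
    "complex \<Rightarrow> nat \<Rightarrow> complex \<Rightarrow> complex \<Rightarrow> complex \<Rightarrow> complex" where
  "gen_cauchy_poly q n x y a =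
     (\<Sum>k\<le>n. qbinom q n k * (-1) ^ k * q ^ (k choose 2) * qpoch a q k * x ^ (n - k) * y ^ k)"

(* The series 1-Phi-1 with upper parameter a and lower parameter fixed to 0;
   the factor (0;q)_n = 1 of the general denominator is therefore absent. *)
definition Phi11_zero :: "complex \<Rightarrow> complex \<Rightarrow> complex \<Rightarrow> complex" where
  "Phi11_zero a q z =
     (\<Sum>n. (-1) ^ n * q ^ (n choose 2) * (qpoch a q n / qpoch q q n) * z ^ n)"

end

theory Submission
  imports Defs
begin

text \<open>
  The \<open>q\<close>-binomial coefficient is a quotient of \<open>q\<close>-factorials, so dividing \<open>p\<^sub>n\<close> by \<open>(q;q)\<^sub>n\<close>
  separates the summation index \<open>k\<close> from \<open>n - k\<close>: the left-hand side is the Cauchy product of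
  the series of \<open>\<^sub>1\<Phi>\<^sub>1\<close> at \<open>y t\<close> with the series \<open>e(z) = \<Sum>n. z\<^sup>n / (q;q)\<^sub>n\<close> at \<open>z = x t\<close>. Both
  converge absolutely by the ratio test (the term ratios tend to \<open>0\<close> and to \<open>z\<close>), so the
  product of the sums is the sum of the Cauchy product.

  It remains to know Euler's identity \<open>e(z) = 1 / (z;q)\<^sub>\<infinity>\<close>. Comparing coefficients gives the
  functional equation \<open>(1 - z) e(z) = e(z q)\<close>; iterating it yields
  \<open>(z;q)\<^sub>n e(z) = e(z q\<^sup>n)\<close>, and the right-hand side tends to \<open>e(0) = 1\<close> by continuity.
\<close>

lemma qpoch_0 [simp]: "qpoch c q 0 = 1"
  by (simp add: qpoch_def)

lemma qpoch_Suc: "qpoch c q (Suc n) = qpoch c q n * (1 - c * q ^ n)"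
  by (simp add: qpoch_def)

lemma one_minus_power_nonzero:
  fixes q :: complex
  assumes "norm q < 1"
  shows "1 - q * q ^ n \<noteq> 0"
proof -
  have "norm (q ^ Suc n) < 1"
    using assms by (simp add: norm_power power_less_one_iff del: power_Suc)
  then show ?thesis
    by auto
qed

lemma qpoch_q_nonzero:
  assumes "norm q < 1"
  shows "qpoch q q n \<noteq> 0"
  using one_minus_power_nonzero[OF assms] by (simp add: qpoch_def)

lemma summable_norm_ratio_limit:
  fixes f r :: "nat \<Rightarrow> complex"
  assumes step: "\<And>n. f (Suc n) = r n * f n"
    and lim: "r \<longlonglongrightarrow> l" and "norm l < 1"
  shows "summable (\<lambda>n. norm (f n))"
proof -
  obtain c where c: "norm l < c" "c < 1"
    using dense \<open>norm l < 1\<close> by blast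
  have "\<forall>\<^sub>F n in sequentially. norm (r n) < c"
    using order_tendstoD(2)[OF tendsto_norm[OF lim] c(1)] .
  then obtain N where N: "\<And>n. n \<ge> N \<Longrightarrow> norm (r n) < c"
    by (auto simp: eventually_sequentially)
  show ?thesis
    by (rule summable_ratio_test[OF c(2), of N])
       (auto simp: step norm_mult intro!: mult_right_mono less_imp_le[OF N])
qed

lemma summable_norm_Euler_series:
  assumes q: "norm q < 1" and z: "norm z < 1"
  shows "summable (\<lambda>n. norm (z ^ n / qpoch q q n))"
proof (rule summable_norm_ratio_limit)
  show "z ^ Suc n / qpoch q q (Suc n) = (z / (1 - q * q ^ n)) * (z ^ n / qpoch q q n)" for n
    by (simp add: qpoch_Suc)
  have "(\<lambda>n. z / (1 - q * q ^ n)) \<longlonglongrightarrow> z / (1 - q * 0)"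
    by (intro tendsto_intros LIMSEQ_power_zero q) auto
  then show "(\<lambda>n. z / (1 - q * q ^ n)) \<longlonglongrightarrow> z"
    by simp
qed (fact z)

lemma summable_norm_Phi11_series:
  assumes q: "norm q < 1"
  shows "summable (\<lambda>n. norm ((-1) ^ n * q ^ (n choose 2) * (qpoch a q n / qpoch q q n) * z ^ n))"
proof (rule summable_norm_ratio_limit)
  show "(-1) ^ Suc n * q ^ (Suc n choose 2) * (qpoch a q (Suc n) / qpoch q q (Suc n)) * z ^ Suc n
      = (- (q ^ n) * (1 - a * q ^ n) / (1 - q * q ^ n) * z)
        * ((-1) ^ n * q ^ (n choose 2) * (qpoch a q n / qpoch q q n) * z ^ n)" for n
    by (simp add: qpoch_Suc numeral_2_eq_2 power_add mult_ac)
  have "(\<lambda>n. - (q ^ n) * (1 - a * q ^ n) / (1 - q * q ^ n) * z)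
      \<longlonglongrightarrow> - 0 * (1 - a * 0) / (1 - q * 0) * z"
    by (intro tendsto_intros LIMSEQ_power_zero q) auto
  then show "(\<lambda>n. - (q ^ n) * (1 - a * q ^ n) / (1 - q * q ^ n) * z) \<longlonglongrightarrow> 0"
    by simp
qed simp

lemma qpoch_tendsto_qpoch_inf:
  assumes q: "norm q < 1"
  shows "qpoch c q \<longlonglongrightarrow> qpoch_inf c q"
proof -
  have "summable (\<lambda>i. norm c * norm q ^ i)"
    using q by (intro summable_mult summable_geometric) simp
  then have "summable (\<lambda>i. norm ((1 - c * q ^ i) - 1))"
    by (simp add: norm_mult norm_power)
  then have "convergent_prod (\<lambda>i. 1 - c * q ^ i)"
    by (intro abs_convergent_prod_imp_convergent_prod)
       (simp add: abs_convergent_prod_conv_summable)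
  then have "(\<lambda>n. \<Prod>i\<le>n. 1 - c * q ^ i) \<longlonglongrightarrow> (\<Prod>i. 1 - c * q ^ i)"
    by (rule convergent_prod_LIMSEQ)
  then have "(\<lambda>n. qpoch c q (Suc n)) \<longlonglongrightarrow> qpoch_inf c q"
    by (simp add: qpoch_def qpoch_inf_def lessThan_Suc_atMost del: prod.lessThan_Suc)
  then show ?thesis
    by (rule LIMSEQ_imp_Suc)
qed

text \<open>
  The coefficients \<open>c\<^sub>n = 1 / (q;q)\<^sub>n\<close> satisfy \<open>(1 - q\<^sup>n\<^sup>+\<^sup>1) c\<^sub>n\<^sub>+\<^sub>1 = c\<^sub>n\<close>, which is
  \<open>e(z) - e(z q) = z e(z)\<close> read off coefficientwise.
\<close>

lemma Euler_series_functional_equation: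
  assumes q: "norm q < 1" and z: "norm z < 1"
  shows "(\<Sum>n. (z * q) ^ n / qpoch q q n) = (1 - z) * (\<Sum>n. z ^ n / qpoch q q n)"
proof -
  let ?e = "\<lambda>z. \<Sum>n. z ^ n / qpoch q q n"
  have zq: "norm (z * q) < 1"
    using mult_strict_mono[OF z q] by (simp add: norm_mult)
  note summ = summable_norm_cancel[OF summable_norm_Euler_series[OF q]]
  have "?e z - ?e (z * q) = (\<Sum>n. z ^ n / qpoch q q n - (z * q) ^ n / qpoch q q n)"
    by (rule suminf_diff[OF summ[OF z] summ[OF zq]])
  also have "\<dots> = (\<Sum>n. z ^ Suc n / qpoch q q (Suc n) - (z * q) ^ Suc n / qpoch q q (Suc n))"
    by (subst suminf_split_head[OF summable_diff[OF summ[OF z] summ[OF zq]]]) simp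
  also have "\<dots> = (\<Sum>n. z * (z ^ n / qpoch q q n))"
  proof (rule suminf_cong)
    fix n
    have "z ^ Suc n / qpoch q q (Suc n) - (z * q) ^ Suc n / qpoch q q (Suc n)
        = z * z ^ n * (1 - q * q ^ n) / (qpoch q q n * (1 - q * q ^ n))"
      by (simp add: qpoch_Suc power_mult_distrib algebra_simps diff_divide_distrib)
    then show "z ^ Suc n / qpoch q q (Suc n) - (z * q) ^ Suc n / qpoch q q (Suc n)
        = z * (z ^ n / qpoch q q n)"
      using one_minus_power_nonzero[OF q, of n] by simp
  qed
  also have "\<dots> = z * ?e z"
    by (rule suminf_mult[OF summ[OF z]])
  finally show ?thesis
    by (simp add: algebra_simps)
qed

lemma Euler_series_iterated:
  assumes q: "norm q < 1" and z: "norm z < 1"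
  shows "(\<Sum>k. (z * q ^ n) ^ k / qpoch q q k) = qpoch z q n * (\<Sum>k. z ^ k / qpoch q q k)"
proof (induction n)
  case (Suc n)
  have "norm (q ^ n) \<le> 1"
    using q by (simp add: norm_power power_le_one)
  then have "norm (z * q ^ n) < 1"
    using z mult_left_mono[of "norm (q ^ n)" 1 "norm z"] by (simp add: norm_mult)
  from Euler_series_functional_equation[OF q this] show ?case
    by (simp add: Suc.IH qpoch_Suc mult_ac)
qed simp

text \<open>
  The limit of the iterated functional equation. It also shows that \<open>(z;q)\<^sub>\<infinity>\<close> does not vanish,
  as its product with \<open>e(z)\<close> is \<open>1\<close>.
\<close>

lemma Euler_series_eq_inverse_qpoch_inf:
  assumes q: "norm q < 1" and z: "norm z < 1"
  shows "(\<Sum>n. z ^ n / qpoch q q n) = 1 / qpoch_inf z q"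
proof -
  let ?e = "\<lambda>z. \<Sum>n. z ^ n / qpoch q q n"
  \<comment> \<open>Any point of the punctured unit disc serves to show that the radius of convergence
    is positive.\<close>
  have "summable (\<lambda>n. inverse (qpoch q q n) * (1/2) ^ n)"
    using summable_norm_cancel[OF summable_norm_Euler_series[OF q, of "1/2"]]
    by (simp add: field_simps)
  then have "isCont (\<lambda>z. \<Sum>n. inverse (qpoch q q n) * z ^ n) 0"
    by (rule isCont_powser) simp
  then have "isCont ?e 0"
    by (simp add: divide_inverse mult.commute)
  moreover have "(\<lambda>n. z * q ^ n) \<longlonglongrightarrow> 0"
    using tendsto_mult_left[OF LIMSEQ_power_zero[OF q], of z] by simp
  ultimately have "(\<lambda>n. ?e (z * q ^ n)) \<longlonglongrightarrow> ?e 0"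
    by (rule isCont_tendsto_compose)
  moreover have "?e 0 = 1"
    using powser_zero[of "\<lambda>n. inverse (qpoch q q n)"] by (simp add: divide_inverse mult.commute)
  ultimately have "(\<lambda>n. qpoch z q n * ?e z) \<longlonglongrightarrow> 1"
    by (simp add: Euler_series_iterated[OF q z])
  moreover have "(\<lambda>n. qpoch z q n * ?e z) \<longlonglongrightarrow> qpoch_inf z q * ?e z"
    by (intro tendsto_intros qpoch_tendsto_qpoch_inf q)
  ultimately have "qpoch_inf z q * ?e z = 1"
    by (rule LIMSEQ_unique[symmetric])
  then show ?thesis
    by (auto simp: eq_divide_eq mult.commute)
qed

text \<open>
  The factor \<open>(q;q)\<^sub>n\<close> of the \<open>q\<close>-binomial coefficient cancels, and \<open>t\<^sup>n = t\<^sup>k t\<^sup>n\<^sup>-\<^sup>k\<close> is shared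
  between the two series.
\<close>

lemma gen_cauchy_poly_term_eq_convolution:
  assumes q: "norm q < 1"
  shows "gen_cauchy_poly q n x y a * (t ^ n / qpoch q q n)
    = (\<Sum>k\<le>n. ((-1) ^ k * q ^ (k choose 2) * (qpoch a q k / qpoch q q k) * (y * t) ^ k)
          * ((x * t) ^ (n - k) / qpoch q q (n - k)))"
  unfolding gen_cauchy_poly_def sum_distrib_right
proof (rule sum.cong[OF refl])
  fix k assume "k \<in> {..n}"
  then have "t ^ n = t ^ k * t ^ (n - k)"
    by (simp flip: power_add)
  then show "qbinom q n k * (-1) ^ k * q ^ (k choose 2) * qpoch a q k * x ^ (n - k) * y ^ k
        * (t ^ n / qpoch q q n)
      = ((-1) ^ k * q ^ (k choose 2) * (qpoch a q k / qpoch q q k) * (y * t) ^ k)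
          * ((x * t) ^ (n - k) / qpoch q q (n - k))"
    using qpoch_q_nonzero[OF q] by (simp add: qbinom_def power_mult_distrib field_simps)
qed

theorem theorem2p2:
  fixes q :: real and x y a t :: complex
  assumes "0 < q" and "q < 1" and "norm (x * t) < 1"
  shows "(\<lambda>n. gen_cauchy_poly (of_real q) n x y a * (t ^ n / qpoch (of_real q) (of_real q) n))
           sums (1 / qpoch_inf (x * t) (of_real q) * Phi11_zero a (of_real q) (y * t))"
proof -
  have q: "norm (complex_of_real q) < 1"
    using assms by simp
  show ?thesis
    using Cauchy_product_sums[OF summable_norm_Phi11_series[OF q, of a "y * t"]
        summable_norm_Euler_series[OF q assms(3)]]
    by (simp only: gen_cauchy_poly_term_eq_convolution[OF q] Phi11_zero_def
        Euler_series_eq_inverse_qpoch_inf[OF q assms(3)]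
        mult.commute[of "1 / qpoch_inf (x * t) (of_real q)"])
qed

end
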